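(* Let $R$ be a semiprime left noetherian ring and let $L$ be an essential left ideal of $R$. Then every endomorphism $\sigma$ of $R$ such that $\sigma(L)=L$ is an automorphism of $R$.
   Context: Rings are associative with unity, not necessarily commutative. *)

theory Defs
  imports "HOL-Algebra.Algebra"
begin

locale left_ideal = additive_subgroup I R + ring R for I and R (structure) +
  assumes I_l_closed: "\<lbrakk>a \<in> I; x \<in> carrier R\<rbrakk> \<Longrightarrow> x \<otimes> a \<in> I"

locale essential_left_ideal = left_ideal L R for L and R (structure) +
  assumes essential: "\<lbrakk>left_ideal J R; J \<noteq> {\<zero>}\<rbrakk> \<Longrightarrow> L \<inter> J \<noteq> {\<zero>}"

text \<open>The zero ideal is a semiprime ideal. Here \<open>I \<cdot> I\<close> is the product of ideals,
  i.e. the set of finite sums of products, not the elementwise product.\<close>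

locale semiprime_ring = ring R for R (structure) +
  assumes semiprime: "\<lbrakk>ideal I R; I \<cdot> I = {\<zero>}\<rbrakk> \<Longrightarrow> I = {\<zero>}"

text \<open>The ascending chain condition on left ideals. The library's \<^locale>\<open>noetherian_ring\<close>
  concerns two-sided ideals only, which is a weaker condition for noncommutative rings.\<close>

locale left_noetherian_ring = ring R for R (structure) +
  assumes acc: "\<lbrakk>\<And>n::nat. left_ideal (C n) R; \<And>n. C n \<subseteq> C (Suc n)\<rbrakk>
      \<Longrightarrow> \<exists>N. \<forall>n\<ge>N. C n = C N"

end

theory Submission
  imports Defs
begin

text \<open>
  Injectivity is the argument for surjective endomorphisms of noetherian modules. The kernels of
  the powers of \<open>\<sigma>\<close> form an ascending chain, so they stabilise; as \<open>\<sigma>\<close> maps \<open>L\<close> onto itself, this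
  forces \<open>ker \<sigma> \<inter> L = 0\<close>, and essentiality gives \<open>ker \<sigma> = 0\<close>.

  For surjectivity, view \<open>R\<close> through \<open>\<sigma>\<close> as the bottom of a tower of overrings
  \<open>R \<subseteq> \<sigma>\<inverse>(R) \<subseteq> \<sigma>\<inverse>\<^sup>2(R) \<subseteq> \<dots>\<close>, all isomorphic to \<open>R\<close>. Since \<open>\<sigma>(L) = L\<close>, the set \<open>L\<close> is a left ideal
  in each of them. If \<open>c \<in> L\<close>, then the products of \<open>c\<close> with the members of the tower are left
  ideals of \<open>R\<close> inside \<open>L\<close>, so they stabilise, and if \<open>c\<close> is cancellable on the right the tower
  itself stabilises, which says that \<open>\<sigma>\<close> is onto. Pulled back to \<open>R\<close>, the left ideals in question
  are \<open>{x \<in> L. \<sigma>\<^sup>n(x) \<in> R \<sigma>\<^sup>n(c)}\<close>.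

  The existence of such a \<open>c\<close> is the part of Goldie's theorem that is needed
  (\<open>essential_contains_cancellable\<close>). Call \<open>b\<close> stable if \<open>b\<close> and \<open>b\<^sup>2\<close> have the same left
  annihilator. Semiprimeness and the chain condition provide nonzero stable elements in every
  nonzero left ideal (\<open>ex_stable_in_left_ideal\<close>). Stable elements can be added up, each killing its
  predecessors from the left, and the left annihilator of the sum is then the intersection of
  theirs. The left ideals that they generate form a direct sum, so the process ends, and by
  essentiality it can only end at an element with zero left annihilator.
\<close>

section \<open>Left ideals and left annihilators\<close>

definition left_annihilator :: "('a, 'm) ring_scheme \<Rightarrow> 'a \<Rightarrow> 'a set" where
  "left_annihilator R a = {x \<in> carrier R. x \<otimes>\<^bsub>R\<^esub> a = \<zero>\<^bsub>R\<^esub>}"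

definition stable_element :: "('a, 'm) ring_scheme \<Rightarrow> 'a \<Rightarrow> bool" where
  "stable_element R b \<longleftrightarrow> b \<in> carrier R \<and>
     left_annihilator R (b \<otimes>\<^bsub>R\<^esub> b) = left_annihilator R b"

context ring
begin

lemma left_idealI:
  assumes "I \<subseteq> carrier R" "\<zero> \<in> I"
    and add: "\<And>a b. a \<in> I \<Longrightarrow> b \<in> I \<Longrightarrow> a \<oplus> b \<in> I"
    and mult: "\<And>a x. a \<in> I \<Longrightarrow> x \<in> carrier R \<Longrightarrow> x \<otimes> a \<in> I"
  shows "left_ideal I R"
proof -
  have "\<ominus> a \<in> I" if "a \<in> I" for a
    using mult[OF that, of "\<ominus> \<one>"] that assms(1) l_minus[of \<one> a] by auto
  then have "subgroup I (add_monoid R)"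
    using assms by (intro add.subgroupI) (auto simp: a_inv_def)
  then show ?thesis
    using mult ring_axioms
    by (simp add: left_ideal_def left_ideal_axioms_def additive_subgroup_def)
qed

lemma left_ideal_zero_mem: "left_ideal I R \<Longrightarrow> \<zero> \<in> I"
  by (simp add: left_ideal_def additive_subgroup.zero_closed)

lemma idealI_left:
  assumes "left_ideal I R"
    and "\<And>a x. a \<in> I \<Longrightarrow> x \<in> carrier R \<Longrightarrow> a \<otimes> x \<in> I"
  shows "ideal I R"
proof -
  interpret left_ideal I R by fact
  show ?thesis
    using assms(2) I_l_closed a_subgroup ring_axioms by (intro idealI) auto
qed

lemma left_ideal_left_annihilator:
  assumes "a \<in> carrier R"
  shows "left_ideal (left_annihilator R a) R"
  using assms unfolding left_annihilator_def
  by (intro left_idealI) (auto simp: l_distr m_assoc)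

lemma left_ideal_Int:
  assumes "left_ideal I R" "left_ideal J R"
  shows "left_ideal (I \<inter> J) R"
proof -
  interpret I: left_ideal I R by fact
  interpret J: left_ideal J R by fact
  show ?thesis
    by (intro left_idealI) (use I.a_subset in \<open>auto simp: I.I_l_closed J.I_l_closed\<close>)
qed

lemma left_ideal_add_principal:
  assumes "left_ideal I R" "b \<in> carrier R"
  shows "left_ideal {y \<oplus> r \<otimes> b | y r. y \<in> I \<and> r \<in> carrier R} R" (is "left_ideal ?K R")
proof -
  interpret I: left_ideal I R by fact
  note [simp] = I.a_Hcarr assms(2)
  show ?thesis
  proof (rule left_idealI)
    show "?K \<subseteq> carrier R" by auto
    have "\<zero> = \<zero> \<oplus> \<zero> \<otimes> b" by simp
    then show "\<zero> \<in> ?K" using left_ideal_zero_mem[OF assms(1)] by blast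
  next
    fix u v assume "u \<in> ?K" "v \<in> ?K"
    then obtain y r z s where *: "u = y \<oplus> r \<otimes> b" "v = z \<oplus> s \<otimes> b"
      "y \<in> I" "z \<in> I" "r \<in> carrier R" "s \<in> carrier R" by blast
    then have "u \<oplus> v = (y \<oplus> z) \<oplus> (r \<oplus> s) \<otimes> b"
      by (simp add: l_distr a_ac)
    then show "u \<oplus> v \<in> ?K" using * by blast
  next
    fix u x assume "u \<in> ?K" and x: "x \<in> carrier R"
    then obtain y r where *: "u = y \<oplus> r \<otimes> b" "y \<in> I" "r \<in> carrier R" by blast
    then have "x \<otimes> u = (x \<otimes> y) \<oplus> (x \<otimes> r) \<otimes> b"
      using x by (simp add: r_distr m_assoc)
    then show "x \<otimes> u \<in> ?K" using * x I.I_l_closed by blast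
  qed
qed

text \<open>Left annihilators of stable elements intersect when the elements are added in the right
  order: multiplying a relation \<open>x (a + b) = 0\<close> by \<open>a\<close> on the right kills the term in \<open>b\<close> and
  leaves \<open>x a\<^sup>2 = 0\<close>.\<close>

lemma left_annihilator_add:
  assumes "stable_element R a" "b \<in> left_annihilator R a"
  shows "left_annihilator R (a \<oplus> b) = left_annihilator R a \<inter> left_annihilator R b"
proof -
  have car: "a \<in> carrier R" "b \<in> carrier R" and ba: "b \<otimes> a = \<zero>"
    using assms by (auto simp: stable_element_def left_annihilator_def)
  have "x \<otimes> a = \<zero> \<and> x \<otimes> b = \<zero>" if x: "x \<in> carrier R" "x \<otimes> (a \<oplus> b) = \<zero>" for x
  proof -
    have "x \<otimes> (a \<otimes> a) = x \<otimes> (a \<oplus> b) \<otimes> a"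
      using x(1) car ba by (simp add: m_assoc l_distr)
    then have "x \<in> left_annihilator R (a \<otimes> a)"
      using x car by (simp add: left_annihilator_def)
    then have "x \<otimes> a = \<zero>"
      using assms(1) by (auto simp: stable_element_def left_annihilator_def)
    then show ?thesis using x car by (simp add: r_distr)
  qed
  moreover have "x \<otimes> (a \<oplus> b) = \<zero>" if "x \<in> carrier R" "x \<otimes> a = \<zero>" "x \<otimes> b = \<zero>" for x
    using that car by (simp add: r_distr)
  ultimately show ?thesis
    unfolding left_annihilator_def by blast
qed

lemma stable_element_add:
  assumes "stable_element R a" "stable_element R b" "b \<in> left_annihilator R a"
  shows "stable_element R (a \<oplus> b)"
proof -
  let ?c = "a \<oplus> b"
  have car: "a \<in> carrier R" "b \<in> carrier R" and ba: "b \<otimes> a = \<zero>"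
    using assms by (auto simp: stable_element_def left_annihilator_def)
  have "x \<otimes> ?c = \<zero>" if x: "x \<in> carrier R" "x \<otimes> (?c \<otimes> ?c) = \<zero>" for x
  proof -
    have "x \<otimes> ?c \<in> left_annihilator R ?c"
      using x car by (simp add: left_annihilator_def m_assoc)
    then have ca: "x \<otimes> ?c \<otimes> a = \<zero>" and cb: "x \<otimes> ?c \<otimes> b = \<zero>"
      using left_annihilator_add[OF assms(1,3)] by (auto simp: left_annihilator_def)
    have "x \<otimes> (a \<otimes> a) = x \<otimes> ?c \<otimes> a"
      using x(1) car ba by (simp add: m_assoc l_distr)
    then have xa: "x \<otimes> a = \<zero>"
      using ca x assms(1) by (auto simp: stable_element_def left_annihilator_def)
    have "x \<otimes> (b \<otimes> b) = x \<otimes> ?c \<otimes> b"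
      using x(1) car xa by (simp add: m_assoc l_distr r_distr flip: m_assoc)
    then have "x \<otimes> b = \<zero>"
      using cb x assms(2) by (auto simp: stable_element_def left_annihilator_def)
    with xa show ?thesis using x car by (simp add: r_distr)
  qed
  moreover have "x \<otimes> (?c \<otimes> ?c) = \<zero>" if x: "x \<in> carrier R" "x \<otimes> ?c = \<zero>" for x
    using x car m_assoc[of x ?c ?c] by simp
  moreover have "?c \<in> carrier R" using car by simp
  ultimately show ?thesis
    unfolding stable_element_def left_annihilator_def by blast
qed

end

lemma (in essential_left_ideal) left_ideal_trivial:
  assumes "left_ideal J R" "\<And>x. x \<in> L \<Longrightarrow> x \<in> J \<Longrightarrow> x = \<zero>"
  shows "J = {\<zero>}"
proof -
  have "\<zero> \<in> L" "\<zero> \<in> J"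
    using left_ideal_axioms assms(1) by (auto intro: left_ideal_zero_mem)
  then have "L \<inter> J = {\<zero>}" using assms(2) by blast
  then show ?thesis using essential[OF assms(1)] by blast
qed

lemma (in left_noetherian_ring) chain_stops:
  fixes C :: "nat \<Rightarrow> 'a set"
  assumes "\<And>n. left_ideal (C n) R" "\<And>n. C n \<subseteq> C (Suc n)"
  obtains N where "C (Suc N) = C N"
proof -
  obtain N where N: "\<forall>n\<ge>N. C n = C N" using acc[of C, OF assms] ..
  show thesis by (rule that, rule N[rule_format]) simp
qed

text \<open>The chain condition as a maximum condition: a family without a maximal member would allow a
  strictly ascending sequence to be chosen.\<close>

lemma (in left_noetherian_ring) ex_maximal_left_ideal:
  assumes "I0 \<in> F" "\<And>I. I \<in> F \<Longrightarrow> left_ideal I R"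
  shows "\<exists>I\<in>F. \<forall>J\<in>F. I \<subseteq> J \<longrightarrow> J = I"
proof (rule ccontr)
  assume "\<not> ?thesis"
  then have step: "\<exists>J. J \<in> F \<and> I \<subset> J" if "I \<in> F" for I
    using that by blast
  have "\<exists>C :: nat \<Rightarrow> 'a set. \<forall>n. C n \<in> F \<and> C n \<subset> C (Suc n)"
    using assms(1) step by (intro dependent_nat_choice) blast+
  then obtain C :: "nat \<Rightarrow> 'a set" where C: "\<And>n. C n \<in> F" "\<And>n. C n \<subset> C (Suc n)"
    by blast
  have "left_ideal (C n) R" "C n \<subseteq> C (Suc n)" for n
    using C assms(2) by blast+
  then obtain N where "C (Suc N) = C N" by (rule chain_stops)
  then show False using C(2)[of N] by simp
qed

section \<open>Elements with zero left annihilator\<close>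

text \<open>The elementwise form of semiprimeness. Let \<open>K\<close> be the ideal of all \<open>x\<close> with \<open>a R x = 0\<close>.
  If \<open>a R a = 0\<close>, then \<open>a\<close> lies in \<open>K\<close> and annihilates \<open>K\<close>, and the elements of \<open>K\<close> that
  annihilate \<open>K\<close> form an ideal of square zero.\<close>

lemma (in semiprime_ring) semiprime_elementwise:
  assumes a: "a \<in> carrier R" and aRa: "\<And>r. r \<in> carrier R \<Longrightarrow> a \<otimes> r \<otimes> a = \<zero>"
  shows "a = \<zero>"
proof -
  define K where "K = {x \<in> carrier R. \<forall>r\<in>carrier R. a \<otimes> r \<otimes> x = \<zero>}"
  define I where "I = {y \<in> K. \<forall>x\<in>K. y \<otimes> x = \<zero>}"
  have K_car: "x \<in> carrier R" if "x \<in> K" for x using that by (simp add: K_def)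
  have K_l: "s \<otimes> x \<in> K" if "x \<in> K" "s \<in> carrier R" for s x
  proof -
    have "a \<otimes> r \<otimes> (s \<otimes> x) = \<zero>" if "r \<in> carrier R" for r
    proof -
      have "a \<otimes> r \<otimes> (s \<otimes> x) = a \<otimes> (r \<otimes> s) \<otimes> x"
        using a that \<open>s \<in> carrier R\<close> K_car[OF \<open>x \<in> K\<close>] by (simp add: m_assoc)
      then show ?thesis using \<open>x \<in> K\<close> \<open>s \<in> carrier R\<close> that by (simp add: K_def)
    qed
    then show ?thesis using that by (simp add: K_def)
  qed
  have K_r: "x \<otimes> s \<in> K" if "x \<in> K" "s \<in> carrier R" for s x
    using that a by (auto simp: K_def simp flip: m_assoc)
  have K_add: "x \<oplus> y \<in> K" if "x \<in> K" "y \<in> K" for x y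
    using that a by (auto simp: K_def r_distr)
  have K_zero: "\<zero> \<in> K" using a by (simp add: K_def)
  have "left_ideal I R"
    by (intro left_idealI) (auto simp: I_def K_car K_l K_add K_zero l_distr m_assoc)
  then have ideal: "ideal I R"
    by (rule idealI_left) (auto simp: I_def K_car K_l K_r m_assoc)
  have "I \<cdot> I = {\<zero>}"
  proof -
    have "x = \<zero>" if "x \<in> I \<cdot> I" for x
      using that by (induction rule: ideal_prod.induct) (auto simp: I_def)
    moreover have "\<zero> \<in> I \<cdot> I"
    proof -
      have "\<zero> \<in> I" by (simp add: I_def K_zero K_car)
      then have "\<zero> \<otimes> \<zero> \<in> I \<cdot> I" by (intro ideal_prod.prod)
      then show ?thesis by simp
    qed
    ultimately show ?thesis by blast
  qed
  then have "I = {\<zero>}" using semiprime ideal by blast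
  moreover have "a \<in> I"
  proof -
    have "a \<otimes> x = \<zero>" if "x \<in> K" for x
    proof -
      have "a \<otimes> \<one> \<otimes> x = \<zero>" using that unfolding K_def by blast
      then show ?thesis using a by simp
    qed
    then show ?thesis using a aRa by (simp add: I_def K_def)
  qed
  ultimately show ?thesis by blast
qed

text \<open>This replaces the usual argument through nil ideals. Start from a nonzero \<open>a \<in> J\<close> and choose a
  nonzero right multiple \<open>d = a s\<close> whose left annihilator is maximal; then all nonzero right
  multiples of \<open>d\<close> have the same left annihilator as \<open>d\<close>. Semiprimeness gives \<open>r\<close> with
  \<open>d r d \<noteq> 0\<close>, and \<open>s r d r a\<close> is stable: it and its square are both of the form \<open>s r\<close> times a
  nonzero right multiple of \<open>d\<close>.\<close>

lemma (in left_noetherian_ring) ex_stable_in_left_ideal: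
  assumes "semiprime_ring R" "left_ideal J R" "J \<noteq> {\<zero>}"
  obtains b where "b \<in> J" "b \<noteq> \<zero>" "stable_element R b"
proof -
  interpret semiprime_ring R by fact
  interpret J: left_ideal J R by fact
  obtain a where aJ: "a \<in> J" and a0: "a \<noteq> \<zero>"
    using assms(3) left_ideal_zero_mem[OF assms(2)] by blast
  have a: "a \<in> carrier R" using aJ by (rule J.a_Hcarr)
  define F where "F = {left_annihilator R (a \<otimes> s) | s. s \<in> carrier R \<and> a \<otimes> s \<noteq> \<zero>}"
  have "left_annihilator R (a \<otimes> \<one>) \<in> F"
    unfolding F_def using a a0 by (intro CollectI exI[of _ \<one>]) simp
  moreover have "left_ideal I R" if "I \<in> F" for I
    using that a left_ideal_left_annihilator by (auto simp: F_def)
  ultimately have "\<exists>M\<in>F. \<forall>I\<in>F. M \<subseteq> I \<longrightarrow> I = M"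
    by (rule ex_maximal_left_ideal)
  then obtain M where M: "M \<in> F" "\<And>I. I \<in> F \<Longrightarrow> M \<subseteq> I \<Longrightarrow> I = M"
    by blast
  obtain s where s: "s \<in> carrier R" "a \<otimes> s \<noteq> \<zero>" "M = left_annihilator R (a \<otimes> s)"
    using M(1) by (auto simp: F_def)
  define d where "d = a \<otimes> s"
  have d: "d \<in> carrier R" "d \<noteq> \<zero>" using a s by (auto simp: d_def)
  have mult_ann: "x \<otimes> (d \<otimes> t) = \<zero> \<longleftrightarrow> x \<otimes> d = \<zero>"
    if t: "t \<in> carrier R" "d \<otimes> t \<noteq> \<zero>" and x: "x \<in> carrier R" for t x
  proof -
    have "d \<otimes> t = a \<otimes> (s \<otimes> t)" using a s t by (simp add: d_def m_assoc)
    then have "left_annihilator R (d \<otimes> t) \<in> F"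
      unfolding F_def using s t by auto
    moreover have "M \<subseteq> left_annihilator R (d \<otimes> t)"
      using d t s(3) by (auto simp: left_annihilator_def simp flip: d_def m_assoc)
    ultimately have "left_annihilator R (d \<otimes> t) = left_annihilator R d"
      using M(2) s(3) by (simp add: d_def)
    then show ?thesis using x by (auto simp: left_annihilator_def)
  qed
  obtain r where r: "r \<in> carrier R" "d \<otimes> r \<otimes> d \<noteq> \<zero>"
    using semiprime_elementwise[of d] d by blast
  note car = a s(1) d(1) r(1)
  have drt: "d \<otimes> (r \<otimes> (d \<otimes> t)) \<noteq> \<zero>" if "t \<in> carrier R" "d \<otimes> t \<noteq> \<zero>" for t
    using mult_ann[of t "d \<otimes> r"] that r car by (simp add: m_assoc)
  have dra: "d \<otimes> (r \<otimes> a) \<noteq> \<zero>"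
  proof
    assume "d \<otimes> (r \<otimes> a) = \<zero>"
    moreover have "d \<otimes> r \<otimes> d = d \<otimes> (r \<otimes> a) \<otimes> s"
      using car by (simp add: d_def m_assoc)
    ultimately show False using r car by simp
  qed
  define b where "b = s \<otimes> (r \<otimes> (d \<otimes> (r \<otimes> a)))"
  have b: "b \<in> carrier R" using car by (simp add: b_def)
  have bb: "b \<otimes> b = s \<otimes> (r \<otimes> (d \<otimes> (r \<otimes> (d \<otimes> (r \<otimes> (d \<otimes> (r \<otimes> a)))))))"
    using car by (simp add: b_def m_assoc) (simp add: d_def m_assoc)
  have ann_b: "x \<otimes> b = \<zero> \<longleftrightarrow> x \<otimes> s \<otimes> r \<otimes> d = \<zero>" if "x \<in> carrier R" for x
    using mult_ann[of "r \<otimes> a" "x \<otimes> s \<otimes> r"] dra that car by (simp add: b_def m_assoc)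
  have ann_bb: "x \<otimes> (b \<otimes> b) = \<zero> \<longleftrightarrow> x \<otimes> s \<otimes> r \<otimes> d = \<zero>" if "x \<in> carrier R" for x
    using mult_ann[of "r \<otimes> (d \<otimes> (r \<otimes> (d \<otimes> (r \<otimes> a))))" "x \<otimes> s \<otimes> r"] that car dra
      drt[of "r \<otimes> a"] drt[of "r \<otimes> (d \<otimes> (r \<otimes> a))"]
    by (simp add: bb m_assoc)
  show thesis
  proof
    have "b = s \<otimes> r \<otimes> d \<otimes> r \<otimes> a" using car by (simp add: b_def m_assoc)
    then show "b \<in> J" using J.I_l_closed[OF aJ] car by simp
    show "b \<noteq> \<zero>"
    proof
      assume "b = \<zero>"
      then have "a \<otimes> b = \<zero>" using a by simp
      then have "a \<otimes> s \<otimes> r \<otimes> d = \<zero>" using ann_b a by simp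
      then show False using r(2) by (simp add: d_def)
    qed
    show "stable_element R b"
      using b ann_b ann_bb by (auto simp: stable_element_def left_annihilator_def)
  qed
qed

text \<open>Among the left ideals that meet the left annihilator of some stable \<open>c \<in> L\<close> trivially, take a
  maximal one, \<open>I\<close>. If \<open>L \<inter> ann(c)\<close> were nonzero, it would contain a stable \<open>b \<noteq> 0\<close>, for which
  \<open>b c = 0\<close>, and \<open>I + R b\<close> would contradict maximality through the stable element \<open>c + b\<close>. The
  left ideals \<open>I\<close> serve to trade the descending annihilators for an ascending chain.\<close>

lemma (in left_noetherian_ring) essential_contains_cancellable:
  assumes "semiprime_ring R" "essential_left_ideal L R"
  obtains c where "c \<in> L" "left_annihilator R c = {\<zero>}"
proof -
  interpret essential_left_ideal L R by fact
  define good where "good c I \<longleftrightarrow> c \<in> L \<and> stable_element R c \<and> left_ideal I R \<and>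
    I \<inter> left_annihilator R c = {\<zero>}" for c I
  have "left_ideal {\<zero>} R" by (rule left_idealI) auto
  then have "good \<zero> {\<zero>}"
    by (auto simp: good_def stable_element_def left_annihilator_def)
  then have "{\<zero>} \<in> {I. \<exists>c. good c I}" by blast
  moreover have "left_ideal I R" if "I \<in> {I. \<exists>c. good c I}" for I
    using that by (auto simp: good_def)
  ultimately have "\<exists>I\<in>{I. \<exists>c. good c I}. \<forall>J\<in>{I. \<exists>c. good c I}. I \<subseteq> J \<longrightarrow> J = I"
    by (rule ex_maximal_left_ideal)
  then obtain c0 I where "good c0 I" and max: "\<And>J c. good c J \<Longrightarrow> I \<subseteq> J \<Longrightarrow> J = I"
    by blast
  then obtain c where c: "c \<in> L" "stable_element R c" "left_ideal I R"
    and disj: "I \<inter> left_annihilator R c = {\<zero>}"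
    unfolding good_def by blast
  interpret I: left_ideal I R by fact
  have c_car: "c \<in> carrier R" using c(1) by simp
  note ann_ideal = left_ideal_left_annihilator[OF c_car]
  have "L \<inter> left_annihilator R c = {\<zero>}"
  proof (rule ccontr)
    assume nontriv: "L \<inter> left_annihilator R c \<noteq> {\<zero>}"
    have "left_ideal (L \<inter> left_annihilator R c) R"
      using left_ideal_axioms ann_ideal by (rule left_ideal_Int)
    then obtain b where b: "b \<in> L" "b \<in> left_annihilator R c" "b \<noteq> \<zero>" "stable_element R b"
      using ex_stable_in_left_ideal[OF assms(1) _ nontriv] by blast
    have b_car: "b \<in> carrier R" and bc: "b \<otimes> c = \<zero>"
      using b by (auto simp: left_annihilator_def)
    define J where "J = {y \<oplus> r \<otimes> b | y r. y \<in> I \<and> r \<in> carrier R}"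
    have J: "left_ideal J R"
      unfolding J_def using c(3) b_car by (rule left_ideal_add_principal)
    note ann_add = left_annihilator_add[OF c(2) b(2)]
    have "x = \<zero>" if "x \<in> J" "x \<in> left_annihilator R (c \<oplus> b)" for x
    proof -
      obtain y r where x: "x = y \<oplus> r \<otimes> b" "y \<in> I" "r \<in> carrier R"
        using \<open>x \<in> J\<close> unfolding J_def by blast
      have y_car: "y \<in> carrier R" using x(2) by (rule I.a_Hcarr)
      have xc: "x \<otimes> c = \<zero>" and xb: "x \<otimes> b = \<zero>"
        using that(2) unfolding ann_add by (simp_all add: left_annihilator_def)
      have "y \<otimes> c = x \<otimes> c"
        using x y_car b_car c_car bc by (simp add: l_distr m_assoc)
      then have "y \<in> I \<inter> left_annihilator R c"
        using xc x y_car by (simp add: left_annihilator_def)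
      then have "y = \<zero>" using disj by blast
      then have "x = r \<otimes> b" using x b_car by simp
      moreover from this have "r \<in> left_annihilator R (b \<otimes> b)"
        using xb x b_car by (simp add: left_annihilator_def m_assoc)
      ultimately show ?thesis
        using b(4) by (auto simp: stable_element_def left_annihilator_def)
    qed
    moreover have "\<zero> \<in> left_annihilator R (c \<oplus> b)"
      using c_car b_car by (simp add: left_annihilator_def)
    ultimately have "J \<inter> left_annihilator R (c \<oplus> b) = {\<zero>}"
      using left_ideal_zero_mem[OF J] by blast
    then have "good (c \<oplus> b) J"
      using c(1,2) b J stable_element_add by (simp add: good_def)
    moreover have "I \<subseteq> J"
    proof
      fix y assume "y \<in> I"
      moreover from this have "y = y \<oplus> \<zero> \<otimes> b" using b_car I.a_Hcarr by simp
      ultimately show "y \<in> J" unfolding J_def by blast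
    qed
    ultimately have "J = I" by (rule max)
    moreover have "b \<in> J"
    proof -
      have "b = \<zero> \<oplus> \<one> \<otimes> b" using b_car by simp
      then show ?thesis unfolding J_def using left_ideal_zero_mem[OF c(3)] by blast
    qed
    ultimately show False using disj b by blast
  qed
  then have "left_annihilator R c = {\<zero>}"
    by (intro left_ideal_trivial[OF ann_ideal]) auto
  with c(1) show thesis by (rule that)
qed

section \<open>Endomorphisms that preserve an essential left ideal\<close>

lemma ring_hom_funpow:
  fixes R (structure) and \<sigma> :: "'a \<Rightarrow> 'a"
  assumes "ring R" "\<sigma> \<in> ring_hom R R"
  shows "\<sigma> ^^ n \<in> ring_hom R R"
proof -
  interpret ring R by fact
  show ?thesis
    using assms(2)
    by (induction n) (auto simp: ring_hom_def Pi_iff)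
qed

lemma funpow_image_eq:
  assumes "f ` A = A"
  shows "(f ^^ n) ` A = A"
proof (induction n)
  case (Suc n)
  have "(f ^^ Suc n) ` A = f ` ((f ^^ n) ` A)" by (simp add: image_image)
  then show ?case using Suc assms by simp
qed simp

lemma (in left_noetherian_ring) inj_on_of_essential_image:
  fixes \<sigma> :: "'a \<Rightarrow> 'a"
  assumes "essential_left_ideal L R" "\<sigma> \<in> ring_hom R R" "\<sigma> ` L = L"
  shows "inj_on \<sigma> (carrier R)"
proof -
  interpret essential_left_ideal L R by fact
  interpret hom: ring_hom_ring R R "\<sigma> ^^ n" for n
    using ring_axioms ring_hom_funpow[OF ring_axioms assms(2)]
    by (intro ring_hom_ringI2)
  interpret \<sigma>: ring_hom_ring R R \<sigma>
    using ring_axioms assms(2) by (intro ring_hom_ringI2)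
  define C where "C n = {x \<in> carrier R. (\<sigma> ^^ n) x = \<zero>}" for n
  have C: "left_ideal (C n) R" for n
    unfolding C_def by (intro left_idealI) auto
  moreover have "C n \<subseteq> C (Suc n)" for n
    by (auto simp: C_def)
  ultimately obtain N where N: "C (Suc N) = C N" by (rule chain_stops)
  have "x = \<zero>" if x: "x \<in> L" "x \<in> C 1" for x
  proof -
    obtain y where y: "y \<in> L" "x = (\<sigma> ^^ N) y"
      using x(1) funpow_image_eq[OF assms(3), of N] by (metis imageE)
    then have "y \<in> C (Suc N)" using x(2) by (simp add: C_def)
    then have "y \<in> C N" using N by simp
    then show ?thesis using y by (simp add: C_def)
  qed
  then have "C 1 = {\<zero>}" by (rule left_ideal_trivial[OF C])
  moreover have "a_kernel R R \<sigma> = C 1"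
    unfolding C_def a_kernel_def' by simp
  ultimately have "a_kernel R R \<sigma> = {\<zero>}" by (rule trans[rotated])
  then show ?thesis by (rule \<sigma>.trivial_ker_imp_inj)
qed

text \<open>The powers of \<open>\<sigma>\<close> keep \<open>c\<close> cancellable: on \<open>L\<close> this is transported by \<open>\<sigma>\<^sup>n\<close>, which is
  injective and maps \<open>L\<close> onto itself, and essentiality extends it to the whole ring.\<close>

lemma (in essential_left_ideal) left_annihilator_funpow:
  fixes \<sigma> :: "'a \<Rightarrow> 'a"
  assumes "\<sigma> \<in> ring_hom R R" "\<sigma> ` L = L" "inj_on \<sigma> (carrier R)"
    and c: "c \<in> carrier R" "left_annihilator R c = {\<zero>}"
  shows "left_annihilator R ((\<sigma> ^^ n) c) = {\<zero>}"
proof (rule left_ideal_trivial)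
  interpret hom: ring_hom_ring R R "\<sigma> ^^ n"
    using ring_axioms ring_hom_funpow[OF ring_axioms assms(1)]
    by (intro ring_hom_ringI2)
  have inj: "inj_on (\<sigma> ^^ n) (carrier R)"
  proof (induction n)
    case (Suc n)
    interpret h: ring_hom_ring R R "\<sigma> ^^ n"
      using ring_axioms ring_hom_funpow[OF ring_axioms assms(1)]
      by (intro ring_hom_ringI2)
    have "inj_on \<sigma> ((\<sigma> ^^ n) ` carrier R)"
      using assms(3) by (rule inj_on_subset) auto
    with Suc have "inj_on (\<sigma> \<circ> \<sigma> ^^ n) (carrier R)" by (rule comp_inj_on)
    then show ?case by (simp only: funpow.simps)
  qed simp
  show "left_ideal (left_annihilator R ((\<sigma> ^^ n) c)) R"
    using c by (intro left_ideal_left_annihilator) simp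
  fix x assume x: "x \<in> L" "x \<in> left_annihilator R ((\<sigma> ^^ n) c)"
  obtain y where y: "y \<in> L" "x = (\<sigma> ^^ n) y"
    using x(1) funpow_image_eq[OF assms(2), of n] by (metis imageE)
  have "(\<sigma> ^^ n) (y \<otimes> c) = (\<sigma> ^^ n) \<zero>"
    using x(2) y c by (simp add: left_annihilator_def)
  then have "y \<otimes> c = \<zero>"
    by (rule inj_onD[OF inj]) (use y c in auto)
  then have "y \<in> left_annihilator R c" using y by (simp add: left_annihilator_def)
  then show "x = \<zero>" using c y by simp
qed

text \<open>Stability of the chain at \<open>N\<close> means: the element of \<open>L\<close> that \<open>\<sigma>\<^bsup>N+1\<^esup>\<close> maps to \<open>r \<sigma>\<^bsup>N+1\<^esup>(c)\<close> is
  already mapped by \<open>\<sigma>\<^sup>N\<close> to some \<open>s \<sigma>\<^sup>N(c)\<close>. Applying \<open>\<sigma>\<close> and cancelling gives \<open>r = \<sigma>(s)\<close>.\<close>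

lemma (in left_noetherian_ring) surj_of_essential_image:
  fixes \<sigma> :: "'a \<Rightarrow> 'a"
  assumes "essential_left_ideal L R" "\<sigma> \<in> ring_hom R R" "\<sigma> ` L = L"
    and c: "c \<in> L" "left_annihilator R c = {\<zero>}"
  shows "\<sigma> ` carrier R = carrier R"
proof
  interpret essential_left_ideal L R by fact
  interpret hom: ring_hom_ring R R "\<sigma> ^^ n" for n
    using ring_axioms ring_hom_funpow[OF ring_axioms assms(2)]
    by (intro ring_hom_ringI2)
  interpret \<sigma>: ring_hom_ring R R \<sigma>
    using ring_axioms assms(2) by (intro ring_hom_ringI2)
  have c_car: "c \<in> carrier R" using c(1) by simp
  define C where
    "C n = {x \<in> L. \<exists>s\<in>carrier R. (\<sigma> ^^ n) x = s \<otimes> (\<sigma> ^^ n) c}" for n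
  have "left_ideal (C n) R" for n
  proof (rule left_idealI)
    show "C n \<subseteq> carrier R" using a_subset by (auto simp: C_def)
    have "(\<sigma> ^^ n) \<zero> = \<zero> \<otimes> (\<sigma> ^^ n) c" using c_car by simp
    then show "\<zero> \<in> C n" unfolding C_def using left_ideal_zero_mem[OF left_ideal_axioms] by blast
  next
    fix x y assume "x \<in> C n" "y \<in> C n"
    then obtain s t where *: "x \<in> L" "y \<in> L" "s \<in> carrier R" "t \<in> carrier R"
      "(\<sigma> ^^ n) x = s \<otimes> (\<sigma> ^^ n) c" "(\<sigma> ^^ n) y = t \<otimes> (\<sigma> ^^ n) c"
      by (auto simp: C_def)
    then have "(\<sigma> ^^ n) (x \<oplus> y) = (s \<oplus> t) \<otimes> (\<sigma> ^^ n) c"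
      using c_car by (simp add: l_distr)
    then show "x \<oplus> y \<in> C n" unfolding C_def using * by blast
  next
    fix x r assume "x \<in> C n" and r: "r \<in> carrier R"
    then obtain s where *: "x \<in> L" "s \<in> carrier R" "(\<sigma> ^^ n) x = s \<otimes> (\<sigma> ^^ n) c"
      by (auto simp: C_def)
    then have "(\<sigma> ^^ n) (r \<otimes> x) = ((\<sigma> ^^ n) r \<otimes> s) \<otimes> (\<sigma> ^^ n) c"
      using c_car r by (simp add: m_assoc)
    moreover have "r \<otimes> x \<in> L" using *(1) r by (rule I_l_closed)
    moreover have "(\<sigma> ^^ n) r \<otimes> s \<in> carrier R" using * r by simp
    ultimately show "r \<otimes> x \<in> C n" unfolding C_def by blast
  qed
  moreover have "C n \<subseteq> C (Suc n)" for n
  proof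
    fix x assume "x \<in> C n"
    then obtain s where *: "x \<in> L" "s \<in> carrier R" "(\<sigma> ^^ n) x = s \<otimes> (\<sigma> ^^ n) c"
      by (auto simp: C_def)
    then have "(\<sigma> ^^ Suc n) x = \<sigma> s \<otimes> (\<sigma> ^^ Suc n) c"
      using c_car by simp
    moreover have "\<sigma> s \<in> carrier R" using *(2) by simp
    ultimately show "x \<in> C (Suc n)" unfolding C_def using *(1) by blast
  qed
  ultimately obtain N where N: "C (Suc N) = C N" by (rule chain_stops)
  show "\<sigma> ` carrier R \<subseteq> carrier R" by auto
  show "carrier R \<subseteq> \<sigma> ` carrier R"
  proof
    fix r assume r: "r \<in> carrier R"
    let ?d = "(\<sigma> ^^ Suc N) c"
    have d_car: "?d \<in> carrier R" using c_car by (rule hom.hom_closed)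
    have "?d \<in> L" using c(1) funpow_image_eq[OF assms(3), of "Suc N"] by blast
    then have "r \<otimes> ?d \<in> L" using r by (rule I_l_closed)
    then obtain x where x: "x \<in> L" "(\<sigma> ^^ Suc N) x = r \<otimes> ?d"
      using funpow_image_eq[OF assms(3), of "Suc N"] by (metis imageE)
    then have "x \<in> C (Suc N)" unfolding C_def using r by blast
    then have "x \<in> C N" using N by simp
    then obtain s where s: "s \<in> carrier R" "(\<sigma> ^^ N) x = s \<otimes> (\<sigma> ^^ N) c"
      by (auto simp: C_def)
    then have "(\<sigma> ^^ Suc N) x = \<sigma> s \<otimes> ?d" using c_car by simp
    then have eq: "r \<otimes> ?d = \<sigma> s \<otimes> ?d" using x by simp
    have diff: "(u \<ominus> v) \<otimes> w = \<zero>"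
      if "u \<in> carrier R" "v \<in> carrier R" "w \<in> carrier R" "u \<otimes> w = v \<otimes> w" for u v w
      using that by (simp add: minus_eq l_distr l_minus r_neg)
    have \<sigma>s: "\<sigma> s \<in> carrier R" using s(1) by simp
    have "(r \<ominus> \<sigma> s) \<otimes> ?d = \<zero>" using r \<sigma>s d_car eq by (rule diff)
    then have "r \<ominus> \<sigma> s \<in> left_annihilator R ?d"
      using r \<sigma>s unfolding left_annihilator_def by simp
    moreover have "left_annihilator R ?d = {\<zero>}"
      using assms(2,3) inj_on_of_essential_image[OF assms(1-3)] c_car c(2)
      by (rule left_annihilator_funpow)
    ultimately have "r \<ominus> \<sigma> s = \<zero>" by simp
    then have "r = \<sigma> s" using r \<sigma>s by simp
    then show "r \<in> \<sigma> ` carrier R" using s(1) by simp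
  qed
qed

theorem corollary2p4:
  fixes R :: "('a, 'm) ring_scheme" (structure)
    and L :: "'a set"
    and \<sigma> :: "'a \<Rightarrow> 'a"
  assumes "semiprime_ring R"
    and "left_noetherian_ring R"
    and "essential_left_ideal L R"
    and "\<sigma> \<in> ring_hom R R"
    and "\<sigma> ` L = L"
  shows "\<sigma> \<in> ring_iso R R"
proof -
  interpret left_noetherian_ring R by fact
  obtain c where "c \<in> L" "left_annihilator R c = {\<zero>}"
    using essential_contains_cancellable[OF assms(1,3)] .
  then have "\<sigma> ` carrier R = carrier R"
    by (rule surj_of_essential_image[OF assms(3-5)])
  moreover have "inj_on \<sigma> (carrier R)"
    using assms(3-5) by (rule inj_on_of_essential_image)
  ultimately show ?thesis
    using assms(4) by (simp add: ring_iso_def bij_betw_def)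
qed

end
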